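(* Let $\mathcal{H}$ be a set of $2$-covering $r$-graphs such that no graph in $\mathcal{H}$ is $r$-partite, let $n \in \mathbb{N}$, and let $1 < p < \infty$. Suppose that $G \in \mathfrak{F}(\mathcal{H},n)$ is a graph such that $\rho_p(G) = \Lambda_p(\mathfrak{F}(\mathcal{H}),n)$, and let $\mathbf{x}$ be a Perron-Frobenius eigenvector of $G$ (for the exponent $p$). Then $$\gamma(G,\mathbf{x}) = 1 + O_{p,r}(n^{-1}),$$ that is, there is a constant $C > 0$ depending only on $p$ and $r$ (and not on $\mathcal{H}$, $n$, $G$ or $\mathbf{x}$) such that $|\gamma(G,\mathbf{x}) - 1| \leq C/n$.
   Context: Here $r \geq 2$ is an integer, and an $r$-graph $G$ is a finite simple $r$-uniform hypergraph with vertex set $V(G)$ and edge set $E(G) \subseteq \binom{V(G)}{r}$. An $r$-graph $H$ is $2$-covering if for every two distinct $u,v \in V(H)$ there is an edge of $H$ containing both $u$ and $v$. It is $r$-partite if $V(H)$ can be partitioned into $r$ (possibly empty) parts such that every edge has exactly one vertex in each part. For a set $\mathcal{H}$ of $r$-graphs, $\mathfrak{F}(\mathcal{H})$ is the family of all $r$-graphs $G$ that contain no member of $\mathcal{H}$ as a (not necessarily induced) subgraph, and $\mathfrak{F}(\mathcal{H},n) = \{G \in \mathfrak{F}(\mathcal{H}) : |V(G)| \leq n\}$. For $\mathbf{x} \in \mathbb{R}^{V(G)}$ put $L_G(\mathbf{x}) = r! \sum_{e \in E(G)} \prod_{v \in e} x_v$. The $p$-spectral radius is $\rho_p(G) = \sup\{L_G(\mathbf{x})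 : \|\mathbf{x}\|_p = 1\}$, and $\Lambda_p(\mathfrak{F}(\mathcal{H}),n) = \sup\{\rho_p(G) : G \in \mathfrak{F}(\mathcal{H},n)\}$. A principal eigenvector of $G$ (for $p$) is a vector $\mathbf{x}$ with $\|\mathbf{x}\|_p = 1$, $x_v \geq 0$ for all $v \in V(G)$, and $L_G(\mathbf{x}) = \rho_p(G)$. It is called a Perron-Frobenius eigenvector if moreover $x_v > 0$ for all $v \in V(G)$. For such $\mathbf{x}$ the principal ratio is $\gamma(G,\mathbf{x}) = \sup_{u,v \in V(G)} x_u/x_v$.
   Formalization: The formal theorem assumes n ≥ r; for 2 ≤ n < r no graph on at most n vertices has an edge, so every positive unit vector is a Perron-Frobenius eigenvector and the ratio is unbounded (e.g. r = 3, n = 2, two isolated vertices). *)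

theory Defs
  imports "HOL-Analysis.Analysis" "HOL-Library.Ramsey"
begin

type_synonym 'a hypergraph = "'a set \<times> 'a set set"

abbreviation verts :: "'a hypergraph \<Rightarrow> 'a set" where
  "verts G \<equiv> fst G"

abbreviation edges :: "'a hypergraph \<Rightarrow> 'a set set" where
  "edges G \<equiv> snd G"

definition rgraph :: "nat \<Rightarrow> 'a hypergraph \<Rightarrow> bool" where
  "rgraph r G \<longleftrightarrow> finite (verts G) \<and> edges G \<subseteq> [verts G]\<^bsup>r\<^esup>"

definition two_covering :: "'a hypergraph \<Rightarrow> bool" where
  "two_covering H \<longleftrightarrow>
     (\<forall>u\<in>verts H. \<forall>v\<in>verts H. u \<noteq> v \<longrightarrow> (\<exists>e\<in>edges H. u \<in> e \<and> v \<in> e))"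

definition r_partite :: "nat \<Rightarrow> 'a hypergraph \<Rightarrow> bool" where
  "r_partite r H \<longleftrightarrow>
     (\<exists>P :: nat \<Rightarrow> 'a set. disjoint_family_on P {..<r} \<and> (\<Union>i<r. P i) = verts H \<and>
        (\<forall>e\<in>edges H. \<forall>i<r. card (e \<inter> P i) = 1))"

text \<open>Containment of a not necessarily induced copy: subgraphs are taken up to isomorphism.\<close>

definition contains_copy :: "'a hypergraph \<Rightarrow> 'b hypergraph \<Rightarrow> bool" where
  "contains_copy G H \<longleftrightarrow>
     (\<exists>f. inj_on f (verts H) \<and> f ` verts H \<subseteq> verts G \<and> (\<forall>e\<in>edges H. f ` e \<in> edges G))"

text \<open>Vertices are natural numbers from here on. Every finite hypergraph is isomorphic to one of
  this kind, and a fixed vertex type makes ``all \<open>r\<close>-graphs'' a set.\<close>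

definition free_family :: "nat \<Rightarrow> nat hypergraph set \<Rightarrow> nat hypergraph set" where
  "free_family r \<H> = {G. rgraph r G \<and> (\<forall>H\<in>\<H>. \<not> contains_copy G H)}"

definition free_family_upto :: "nat \<Rightarrow> nat hypergraph set \<Rightarrow> nat \<Rightarrow> nat hypergraph set" where
  "free_family_upto r \<H> n = {G \<in> free_family r \<H>. card (verts G) \<le> n}"

text \<open>A vector indexed by the vertices of \<open>G\<close> is a function on the whole vertex type; the
  notions below read it only on \<open>verts G\<close>.\<close>

definition pnorm :: "real \<Rightarrow> 'a hypergraph \<Rightarrow> ('a \<Rightarrow> real) \<Rightarrow> real" where
  "pnorm p G x = (\<Sum>v\<in>verts G. \<bar>x v\<bar> powr p) powr (1 / p)"

definition lagrangian :: "nat \<Rightarrow> 'a hypergraph \<Rightarrow> ('a \<Rightarrow> real) \<Rightarrow> real" where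
  "lagrangian r G x = fact r * (\<Sum>e\<in>edges G. \<Prod>v\<in>e. x v)"

text \<open>The suprema are taken in the extended reals, so that the graph without vertices, which has
  no vector of norm 1, has spectral radius \<open>-\<infinity>\<close> and does not affect the supremum over a family.
  (The real supremum of the empty set is unspecified.)\<close>

definition spectral_radius :: "nat \<Rightarrow> real \<Rightarrow> 'a hypergraph \<Rightarrow> ereal" where
  "spectral_radius r p G = (SUP x\<in>{x. pnorm p G x = 1}. ereal (lagrangian r G x))"

definition max_spectral_radius :: "nat \<Rightarrow> real \<Rightarrow> nat hypergraph set \<Rightarrow> nat \<Rightarrow> ereal" where
  "max_spectral_radius r p \<H> n = (SUP G\<in>free_family_upto r \<H> n. spectral_radius r p G)"

definition principal_eigenvector :: "nat \<Rightarrow> real \<Rightarrow> 'a hypergraph \<Rightarrow> ('a \<Rightarrow> real) \<Rightarrow> bool" where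
  "principal_eigenvector r p G x \<longleftrightarrow>
     pnorm p G x = 1 \<and> (\<forall>v\<in>verts G. x v \<ge> 0) \<and> ereal (lagrangian r G x) = spectral_radius r p G"

definition perron_frobenius :: "nat \<Rightarrow> real \<Rightarrow> 'a hypergraph \<Rightarrow> ('a \<Rightarrow> real) \<Rightarrow> bool" where
  "perron_frobenius r p G x \<longleftrightarrow>
     principal_eigenvector r p G x \<and> (\<forall>v\<in>verts G. x v > 0)"

definition principal_ratio :: "'a hypergraph \<Rightarrow> ('a \<Rightarrow> real) \<Rightarrow> real" where
  "principal_ratio G x = (SUP (u, v)\<in>verts G \<times> verts G. x u / x v)"

end

theory Submission
  imports Defs
begin

text \<open>
  The proof is Zykov symmetrisation. Replacing a vertex \<open>w\<close> by a twin of another vertex \<open>u\<close> keeps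
  the graph \<open>\<H>\<close>-free: a copy of a 2-covering graph cannot use two twins, because no edge contains
  both, so it can be moved back into the original graph (\<open>contains_copy_clone\<close>). Hence the extremal
  graph \<open>G\<close> with eigenvector \<open>x\<close> does not gain from such a replacement. Write \<open>W\<close> for the value
  \<open>\<Sum>\<^sub>e \<Prod>\<^sub>v\<^sub>\<in>\<^sub>e x\<^sub>v\<close> and \<open>D\<^sub>v\<close>, \<open>D\<^sub>u\<^sub>w\<close> for its partial derivatives. If the twin inherits the weight of
  \<open>w\<close>, the value changes by \<open>x\<^sub>w (D\<^sub>u - D\<^sub>w - x\<^sub>w D\<^sub>u\<^sub>w)\<close>, while the norm stays the same.
  The Lagrange condition \<open>D\<^sub>v = r W x\<^sub>v powr (p - 1)\<close> (\<open>eigenvector_equation\<close>) then turns the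
  inequality \<open>D\<^sub>u - D\<^sub>w \<le> x\<^sub>w D\<^sub>u\<^sub>w\<close> into a bound on the difference of the powers
  \<open>x\<^sub>u powr (p - 1)\<close> and \<open>x\<^sub>w powr (p - 1)\<close>
  (\<open>replace_by_clone\<close>).

  Two estimates make this bound small. The mixed derivative \<open>D\<^sub>u\<^sub>w\<close> is at most the \<open>(r - 2)\<close>-th power
  of the sum of the coordinates, and that sum is at most \<open>n powr (1 - 1/p)\<close> by convexity
  (\<open>codegree_le\<close>). Since the forbidden graphs are not \<open>r\<close>-partite, balanced complete \<open>r\<close>-partite
  graphs are admissible, so \<open>W\<close> is at least a constant times \<open>n powr (r (1 - 1/p))\<close> (\<open>W_lower\<close>).

  An extremal graph has exactly \<open>n\<close> vertices, because otherwise splitting a vertex into two twins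
  would increase the value (\<open>card_V\<close>). Therefore the smallest coordinate \<open>m\<close> and the largest
  coordinate \<open>M\<close> lie on the two sides of \<open>b = n powr (-1/p)\<close>, and the estimates combine to
  \<open>M powr (p - 1) - m powr (p - 1) \<le> K m b powr (p - 2) / n\<close> with \<open>K = (2r)\<^sup>r\<close>. By calculus
  (\<open>ratio_bound\<close>) this forces \<open>M / m = 1 + O(1/n)\<close>.
\<close>

section \<open>Edge polynomials and links\<close>

text \<open>This is the Lagrangian without the factor \<open>r!\<close>. It takes the edge set alone as argument, so that
  it also applies to links, whose edges have fewer than \<open>r\<close> vertices.\<close>

definition edge_poly :: "'a set set \<Rightarrow> ('a \<Rightarrow> real) \<Rightarrow> real" where
  "edge_poly E x = (\<Sum>e\<in>E. \<Prod>v\<in>e. x v)"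

text \<open>The edge polynomial of the link of \<open>v\<close> is the partial derivative of the edge polynomial with
  respect to the coordinate \<open>v\<close>; iterated links give mixed partial derivatives.\<close>

definition link :: "'a set set \<Rightarrow> 'a \<Rightarrow> 'a set set" where
  "link E v = (\<lambda>e. e - {v}) ` {e\<in>E. v \<in> e}"

lemma link_nsets: "E \<subseteq> [V]\<^bsup>k\<^esup> \<Longrightarrow> link E v \<subseteq> nsets (V - {v}) (k - 1)"
  by (auto simp: link_def nsets_def)

lemma nsets_finite: "finite V \<Longrightarrow> E \<subseteq> [V]\<^bsup>k\<^esup> \<Longrightarrow> finite E"
  by (meson finite_imp_finite_nsets finite_subset)

lemma edge_poly_cong:
  assumes "\<And>e v. e \<in> E \<Longrightarrow> v \<in> e \<Longrightarrow> x v = y v"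
  shows "edge_poly E x = edge_poly E y"
  unfolding edge_poly_def by (intro sum.cong prod.cong refl) (use assms in auto)

lemma edge_poly_nonneg:
  assumes "E \<subseteq> [V]\<^bsup>k\<^esup>" "\<And>v. v \<in> V \<Longrightarrow> 0 \<le> x v"
  shows "0 \<le> edge_poly E x"
  unfolding edge_poly_def using assms
  by (intro sum_nonneg prod_nonneg) (unfold nsets_def, blast)

lemma edge_poly_split:
  assumes V: "finite V" and E: "E \<subseteq> [V]\<^bsup>k\<^esup>"
  shows "edge_poly E x = edge_poly {e\<in>E. v \<notin> e} x + x v * edge_poly (link E v) x"
proof -
  have fin: "finite E" using nsets_finite[OF V E] .
  have fe: "finite e" if "e \<in> E" for e using that E by (auto simp: nsets_def)
  have inj: "inj_on (\<lambda>e. e - {v}) {e\<in>E. v \<in> e}"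
    by (rule inj_onI) blast
  have "edge_poly E x = (\<Sum>e\<in>{e\<in>E. v \<notin> e} \<union> {e\<in>E. v \<in> e}. \<Prod>v\<in>e. x v)"
    unfolding edge_poly_def by (rule sum.cong) auto
  also have "\<dots> = edge_poly {e\<in>E. v \<notin> e} x + (\<Sum>e\<in>{e\<in>E. v \<in> e}. \<Prod>v\<in>e. x v)"
    unfolding edge_poly_def using fin by (intro sum.union_disjoint) auto
  also have "(\<Sum>e\<in>{e\<in>E. v \<in> e}. \<Prod>v\<in>e. x v) = (\<Sum>e\<in>{e\<in>E. v \<in> e}. x v * (\<Prod>u\<in>e - {v}. x u))"
    by (intro sum.cong refl) (simp add: prod.remove fe)
  also have "\<dots> = x v * edge_poly (link E v) x"
    unfolding edge_poly_def link_def by (simp add: sum.reindex[OF inj] sum_distrib_left)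
  finally show ?thesis .
qed

text \<open>The edge polynomial is affine in each coordinate, since an edge is a set and contains a vertex
  at most once. So moving one coordinate can be computed exactly, without an error term.\<close>

lemma edge_poly_update:
  assumes V: "finite V" and E: "E \<subseteq> [V]\<^bsup>k\<^esup>"
  shows "edge_poly E (x(v := s)) = edge_poly E x + (s - x v) * edge_poly (link E v) x"
proof -
  have "edge_poly {e\<in>E. v \<notin> e} (x(v := s)) = edge_poly {e\<in>E. v \<notin> e} x"
    by (rule edge_poly_cong) auto
  moreover have "edge_poly (link E v) (x(v := s)) = edge_poly (link E v) x"
    by (rule edge_poly_cong) (auto simp: link_def)
  ultimately show ?thesis
    using edge_poly_split[OF V E, of x v] edge_poly_split[OF V E, of "x(v := s)" v]
    by (simp add: algebra_simps)
qed

lemma edge_poly_scale: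
  assumes E: "E \<subseteq> [V]\<^bsup>k\<^esup>"
  shows "edge_poly E (\<lambda>v. c * x v) = c ^ k * edge_poly E x"
proof -
  have "(\<Prod>v\<in>e. c * x v) = c ^ k * (\<Prod>v\<in>e. x v)" if "e \<in> E" for e
    using that E by (auto simp: prod.distrib nsets_def)
  then show ?thesis by (simp add: edge_poly_def sum_distrib_left)
qed

text \<open>Each set of \<open>k\<close> vertices contributes a monomial that occurs in the expansion of the power.\<close>

lemma edge_poly_le_power:
  assumes "finite V" "E \<subseteq> [V]\<^bsup>k\<^esup>" "\<And>v. v \<in> V \<Longrightarrow> 0 \<le> x v"
  shows "edge_poly E x \<le> (\<Sum>v\<in>V. x v) ^ k"
  using assms
proof (induction V arbitrary: E k rule: finite_induct)
  case empty
  then have "E \<subseteq> (if k = 0 then {{}} else {})" by (simp add: nsets_empty_iff)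
  then show ?case by (cases "k = 0") (auto simp: edge_poly_def subset_singleton_iff)
next
  case (insert v V)
  show ?case
  proof (cases k)
    case 0
    then have "E = {} \<or> E = {{}}" using insert.prems(1) by (auto simp: subset_singleton_iff)
    then show ?thesis using 0 by (auto simp: edge_poly_def)
  next
    case (Suc l)
    let ?S = "\<Sum>u\<in>V. x u"
    have S: "0 \<le> ?S" "0 \<le> x v" using insert.prems(2) by (auto intro: sum_nonneg)
    have 1: "edge_poly {e\<in>E. v \<notin> e} x \<le> ?S ^ Suc l"
      using insert.prems Suc by (intro insert.IH) (auto simp: nsets_def)
    have 2: "edge_poly (link E v) x \<le> ?S ^ l"
      using insert.prems Suc insert.hyps link_nsets[of E "insert v V" k v]
      by (intro insert.IH) auto
    have "edge_poly E x = edge_poly {e\<in>E. v \<notin> e} x + x v * edge_poly (link E v) x"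
      using insert.hyps insert.prems by (intro edge_poly_split[of "insert v V" _ k]) auto
    also have "\<dots> \<le> ?S ^ Suc l + x v * ?S ^ l"
      using 1 2 S by (intro add_mono mult_left_mono) auto
    also have "\<dots> = (x v + ?S) * ?S ^ l" by (simp add: algebra_simps)
    also have "\<dots> \<le> (x v + ?S) * (x v + ?S) ^ l"
      using S by (intro mult_left_mono power_mono) auto
    finally show ?thesis using insert.hyps Suc by simp
  qed
qed

section \<open>Cloning a vertex\<close>

text \<open>The vertex \<open>z\<close> becomes a twin of \<open>u\<close> that shares no edge with \<open>u\<close>. If \<open>z\<close> is fresh, a vertex is
  added; if \<open>z\<close> is already a vertex, its own edges are discarded first, so that \<open>z\<close> is replaced by
  the twin. The proof needs both cases.\<close>

definition clone :: "'a \<Rightarrow> 'a \<Rightarrow> 'a hypergraph \<Rightarrow> 'a hypergraph" where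
  "clone u z G = (insert z (verts G),
     {e\<in>edges G. z \<notin> e} \<union> insert z ` link {e\<in>edges G. z \<notin> e} u)"

lemma rgraph_clone:
  assumes G: "rgraph r G" and r: "r \<ge> 1"
  shows "rgraph r (clone u z G)"
proof -
  have "link {e\<in>edges G. z \<notin> e} u \<subseteq> nsets (verts G - {u}) (r - 1)"
    using G by (intro link_nsets) (auto simp: rgraph_def)
  moreover have "z \<notin> e" if "e \<in> link {e\<in>edges G. z \<notin> e} u" for e
    using that by (auto simp: link_def)
  ultimately have "insert z ` link {e\<in>edges G. z \<notin> e} u \<subseteq> [insert z (verts G)]\<^bsup>r\<^esup>"
    using r by (fastforce simp: nsets_def card_insert_if)
  moreover have "{e\<in>edges G. z \<notin> e} \<subseteq> [insert z (verts G)]\<^bsup>r\<^esup>"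
    using G by (auto simp: rgraph_def nsets_def)
  ultimately show ?thesis using G by (auto simp: rgraph_def clone_def)
qed

text \<open>A copy of \<open>H\<close> in the cloned graph cannot contain both \<open>u\<close> and \<open>z\<close>: an edge of \<open>H\<close> would cover
  the two preimages, but no edge contains both twins. Renaming \<open>z\<close> to \<open>u\<close> is therefore injective on
  the copy and moves it into the original graph.\<close>

lemma contains_copy_clone:
  assumes H: "two_covering H" and u: "u \<in> verts G" "u \<noteq> z"
    and copy: "contains_copy (clone u z G) H"
  shows "contains_copy G H"
proof -
  obtain f where inj: "inj_on f (verts H)" and fV: "f ` verts H \<subseteq> insert z (verts G)"
    and fE: "\<And>e. e \<in> edges H \<Longrightarrow> f ` e \<in> edges (clone u z G)"
    using copy by (auto simp: contains_copy_def clone_def)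
  have not_both: False if ab: "a \<in> verts H" "b \<in> verts H" "f a = z" "f b = u" for a b
  proof -
    have "a \<noteq> b" using ab u by auto
    then obtain e where e: "e \<in> edges H" "a \<in> e" "b \<in> e"
      using H ab(1,2) unfolding two_covering_def by blast
    then have "z \<in> f ` e" "u \<in> f ` e" using ab by auto
    then show False using fE[OF e(1)] u by (auto simp: clone_def link_def)
  qed
  define g where "g v = (if f v = z then u else f v)" for v
  have "inj_on g (verts H)"
  proof (rule inj_onI)
    fix a b assume ab: "a \<in> verts H" "b \<in> verts H" "g a = g b"
    then have "f a = f b"
      using not_both[of a b] not_both[of b a] by (auto simp: g_def split: if_splits)
    then show "a = b" using inj ab by (auto dest: inj_onD)
  qed
  moreover have "g ` verts H \<subseteq> verts G" using fV u by (auto simp: g_def)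
  moreover have "g ` e \<in> edges G" if e: "e \<in> edges H" for e
  proof (cases "z \<in> f ` e")
    case False
    then have "g ` e = f ` e" by (intro image_cong) (auto simp: g_def)
    then show ?thesis using fE[OF e] False by (auto simp: clone_def)
  next
    case True
    then obtain d where d: "d \<in> edges G" "z \<notin> d" "u \<in> d" "f ` e = insert z (d - {u})"
      using fE[OF e] by (auto simp: clone_def link_def)
    have "g ` e = (\<lambda>w. if w = z then u else w) ` (f ` e)"
      by (auto simp: g_def image_image)
    also have "\<dots> = d" unfolding d(4) using d by (auto simp: image_iff)
    finally show ?thesis using d by simp
  qed
  ultimately show ?thesis unfolding contains_copy_def by blast
qed

text \<open>Twins act like a single vertex that carries the sum of their weights. This reduces all
  computations in the cloned graph to the original graph.\<close>

lemma edge_poly_clone: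
  assumes G: "rgraph r G" and uz: "u \<noteq> z"
  shows "edge_poly (edges (clone u z G)) (x(u := s, z := t))
       = edge_poly (edges G) (x(u := s + t, z := 0))"
proof -
  let ?F = "{e\<in>edges G. z \<notin> e}" and ?y = "x(u := s, z := t)"
  have V: "finite (verts G)" and E: "edges G \<subseteq> [verts G]\<^bsup>r\<^esup>" and F: "?F \<subseteq> [verts G]\<^bsup>r\<^esup>"
    using G by (auto simp: rgraph_def)
  have finF: "finite ?F" using nsets_finite[OF V F] .
  have finL: "finite (link ?F u)" 
    unfolding link_def by (rule finite_imageI, rule finite_subset[OF _ finF]) auto
  have zL: "z \<notin> e" "finite e" "u \<notin> e" if "e \<in> link ?F u" for e
    using that F by (auto simp: link_def nsets_def)
  have F_eq: "edge_poly ?F (x(u := a, z := b)) = edge_poly ?F (x(u := a))" for a b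
    by (rule edge_poly_cong) auto
  have inj: "inj_on (insert z) (link ?F u)"
    by (rule inj_onI) (metis zL(1) insert_ident)
  have "edge_poly (edges (clone u z G)) ?y
      = edge_poly ?F ?y + edge_poly (insert z ` link ?F u) ?y"
    unfolding edge_poly_def clone_def snd_conv
    using finF finL by (intro sum.union_disjoint) auto
  also have "edge_poly (insert z ` link ?F u) ?y = (\<Sum>e\<in>link ?F u. t * (\<Prod>v\<in>e. x v))"
    unfolding edge_poly_def sum.reindex[OF inj] o_def
  proof (rule sum.cong[OF refl])
    fix e assume e: "e \<in> link ?F u"
    have "(\<Prod>v\<in>insert z e. ?y v) = t * (\<Prod>v\<in>e. ?y v)" using zL[OF e] by simp
    also have "(\<Prod>v\<in>e. ?y v) = (\<Prod>v\<in>e. x v)"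
      using zL[OF e] by (intro prod.cong) auto
    finally show "(\<Prod>v\<in>insert z e. ?y v) = t * (\<Prod>v\<in>e. x v)" .
  qed
  also have "\<dots> = t * edge_poly (link ?F u) x"
    by (simp add: edge_poly_def sum_distrib_left)
  also have "edge_poly ?F ?y + t * edge_poly (link ?F u) x = edge_poly ?F (x(u := s + t))"
    unfolding F_eq edge_poly_update[OF V F, of x u] by (simp add: algebra_simps)
  also have "\<dots> = edge_poly (edges G) (x(u := s + t, z := 0))"
    using edge_poly_split[OF V E, of "x(u := s + t, z := 0)" z] by (simp add: F_eq)
  finally show ?thesis .
qed

section \<open>Complete multipartite graphs\<close>

text \<open>The complete \<open>r\<close>-partite graph with parts of size \<open>k\<close>. The parts are the residue classes modulo
  \<open>r\<close>, and the edge given by \<open>f\<close> contains the element number \<open>f i\<close> of the class of \<open>i\<close>.\<close>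

definition multipartite :: "nat \<Rightarrow> nat \<Rightarrow> nat hypergraph" where
  "multipartite r k = ({..<r * k},
     (\<lambda>f. (\<lambda>i. i + r * f i) ` {..<r}) ` ({..<r} \<rightarrow>\<^sub>E {..<k}))"

lemma transversal_inter:
  fixes f :: "nat \<Rightarrow> nat"
  assumes "i < r"
  shows "(\<lambda>i. i + r * f i) ` {..<r} \<inter> {v. v mod r = i} = {i + r * f i}"
  using assms by (auto simp: image_iff)

lemma transversal_less: "i < r \<Longrightarrow> j < k \<Longrightarrow> i + r * j < r * (k::nat)"
proof -
  assume "i < r" "j < k"
  then have "i + r * j < r * Suc j" "r * Suc j \<le> r * k" by (simp, intro mult_le_mono) auto
  then show ?thesis by linarith
qed

lemma rgraph_multipartite: "rgraph r (multipartite r k)"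
proof -
  have "inj_on (\<lambda>i. i + r * f i) {..<r}" for f :: "nat \<Rightarrow> nat"
    by (rule inj_onI) (metis lessThan_iff mod_less mod_mult_self2)
  then show ?thesis
    by (auto simp: rgraph_def multipartite_def nsets_def card_image PiE_def Pi_def
        intro!: transversal_less)
qed

lemma r_partite_multipartite:
  assumes "r \<ge> 1" shows "r_partite r (multipartite r k)"
proof -
  let ?P = "\<lambda>i. {v\<in>{..<r * k}. v mod r = i}"
  have "card (e \<inter> ?P i) = 1" if e: "e \<in> edges (multipartite r k)" and i: "i < r" for e i
  proof -
    obtain f where f: "e = (\<lambda>i. i + r * f i) ` {..<r}"
      using e by (auto simp: multipartite_def)
    have "e \<subseteq> {..<r * k}"
      using e rgraph_multipartite[of r k] by (auto simp: rgraph_def nsets_def multipartite_def)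
    then have "e \<inter> ?P i = e \<inter> {v. v mod r = i}" by auto
    then show ?thesis using transversal_inter[OF i, of f] f by simp
  qed
  moreover have "disjoint_family_on ?P {..<r}" by (auto simp: disjoint_family_on_def)
  moreover have "(\<Union>i<r. ?P i) = verts (multipartite r k)"
    using assms by (auto simp: multipartite_def)
  ultimately show ?thesis unfolding r_partite_def by blast
qed

lemma card_edges_multipartite: "card (edges (multipartite r k)) = k ^ r"
proof -
  have "inj_on (\<lambda>f. (\<lambda>i. i + r * f i) ` {..<r}) ({..<r} \<rightarrow>\<^sub>E {..<k})"
  proof (rule inj_onI)
    fix f g :: "nat \<Rightarrow> nat"
    assume fg: "f \<in> {..<r} \<rightarrow>\<^sub>E {..<k}" "g \<in> {..<r} \<rightarrow>\<^sub>E {..<k}"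
      and eq: "(\<lambda>i. i + r * f i) ` {..<r} = (\<lambda>i. i + r * g i) ` {..<r}"
    show "f = g"
    proof (rule PiE_ext[OF fg])
      fix i assume "i \<in> {..<r}"
      then have "{i + r * f i} = {i + r * g i}" "0 < r"
        using transversal_inter[of i r f] transversal_inter[of i r g] eq by auto
      then show "f i = g i" by simp
    qed
  qed
  then show ?thesis by (simp add: multipartite_def card_image card_PiE)
qed

lemma r_partite_contains_copy:
  assumes T: "r_partite r T" and H: "rgraph r H" and copy: "contains_copy T H"
  shows "r_partite r H"
proof -
  obtain P where P: "disjoint_family_on P {..<r}" "(\<Union>i<r. P i) = verts T"
    "\<And>e i. e \<in> edges T \<Longrightarrow> i < r \<Longrightarrow> card (e \<inter> P i) = 1"
    using T unfolding r_partite_def by blast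
  obtain f where inj: "inj_on f (verts H)" and fV: "f ` verts H \<subseteq> verts T"
    and fE: "\<And>e. e \<in> edges H \<Longrightarrow> f ` e \<in> edges T"
    using copy by (auto simp: contains_copy_def)
  let ?Q = "\<lambda>i. {v\<in>verts H. f v \<in> P i}"
  have "card (e \<inter> ?Q i) = 1" if e: "e \<in> edges H" and i: "i < r" for e i
  proof -
    have sub: "e \<subseteq> verts H" using H e by (auto simp: rgraph_def nsets_def)
    have "card (e \<inter> ?Q i) = card (f ` (e \<inter> ?Q i))"
      by (rule card_image[symmetric], rule inj_on_subset[OF inj]) auto
    also have "f ` (e \<inter> ?Q i) = f ` e \<inter> P i" using sub by auto
    finally show ?thesis using P(3)[OF fE[OF e] i] by simp
  qed
  moreover have "disjoint_family_on ?Q {..<r}"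
    using P(1) by (auto simp: disjoint_family_on_def)
  moreover have "(\<Union>i<r. ?Q i) = verts H" using fV P(2) by auto
  ultimately show ?thesis unfolding r_partite_def by (intro exI[of _ ?Q]) auto
qed

section \<open>Real inequalities\<close>

lemma power_mean_powr:
  fixes x :: "'a \<Rightarrow> real"
  assumes V: "finite V" "V \<noteq> {}" and p: "p \<ge> 1" and x: "\<And>v. v \<in> V \<Longrightarrow> x v > 0"
  shows "((\<Sum>v\<in>V. x v) / card V) powr p \<le> (\<Sum>v\<in>V. x v powr p) / card V"
proof -
  have "(\<Sum>v\<in>V. (1 / card V) *\<^sub>R x v) powr p \<le> (\<Sum>v\<in>V. (1 / card V) * x v powr p)"
    by (rule convex_on_sum[OF V powr_convex[OF p]]) (use V x in auto)
  then show ?thesis by (simp add: sum_divide_distrib)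
qed

text \<open>A substitute for Bernoulli's inequality that covers exponents below and above 1 alike, at the
  price of a factor \<open>exp (s * K)\<close>.\<close>

lemma powr_le_one_plus:
  fixes K s t :: real
  assumes "K \<ge> 0" "s \<ge> 0" "0 \<le> t" "t \<le> 1"
  shows "(1 + K * t) powr s \<le> 1 + s * K * exp (s * K) * t"
proof -
  have "(1 + K * t) powr s \<le> exp (K * t) powr s"
    using assms exp_ge_add_one_self[of "K * t"] by (intro powr_mono2) auto
  also have "\<dots> = exp (s * K * t)" by (simp add: powr_def mult_ac)
  also have "\<dots> \<le> 1 + s * K * t * exp (s * K * t)"
  proof -
    have "1 - s * K * t \<le> exp (- (s * K * t))" using exp_ge_add_one_self[of "- (s * K * t)"] by simp
    then have "(1 - s * K * t) * exp (s * K * t) \<le> exp (- (s * K * t)) * exp (s * K * t)"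
      by (intro mult_right_mono) auto
    then show ?thesis by (simp add: exp_minus field_simps)
  qed
  also have "\<dots> \<le> 1 + s * K * t * exp (s * K)"
    using assms by (intro add_left_mono mult_left_mono) (auto intro: mult_left_le)
  finally show ?thesis by (simp add: mult_ac)
qed

text \<open>After rescaling by \<open>b\<close>, the hypothesis reads
  \<open>A powr (p - 1) - a powr (p - 1) \<le> K a t\<close> with \<open>a \<le> 1 \<le> A\<close>. Division by \<open>a powr (p - 1)\<close> gives
  \<open>(A / a) powr (p - 1) \<le> 1 + K t a powr (2 - p)\<close>, so the task is to bound \<open>a powr (2 - p)\<close>. For
  \<open>p \<le> 2\<close> it is at most 1. For \<open>p > 2\<close> a lower bound on \<open>a\<close> is required, and the same hypothesis
  supplies it: \<open>1 \<le> A powr (p - 1) \<le> (1 + K) a\<close>.\<close>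

lemma ratio_bound:
  fixes p K t b m M :: real
  assumes p: "p > 1" and K: "K > 0" and t: "0 \<le> t" "t \<le> 1"
    and b: "0 < m" "m \<le> b" "b \<le> M"
    and le: "M powr (p - 1) - m powr (p - 1) \<le> K * m * b powr (p - 2) * t"
  shows "M / m \<le> 1 + (let L = K * (1 + K) powr p; s = 1 / (p - 1) in s * L * exp (s * L)) * t"
proof -
  define A a q where "A = M / b" and "a = m / b" and "q = M / m"
  have bpos: "b > 0" and Mpos: "M > 0" using b by linarith+
  have a: "0 < a" "a \<le> 1" and A: "1 \<le> A" and q: "q \<ge> 1" and qA: "q = A / a"
    using b bpos by (auto simp: A_def a_def q_def)
  have le': "A powr (p - 1) - a powr (p - 1) \<le> K * a * t"
  proof -
    have bb: "b powr (p - 2) = b powr (p - 1) / b"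
      using bpos powr_diff[of b "p - 1" 1] by simp
    have "(M powr (p - 1) - m powr (p - 1)) / b powr (p - 1)
        \<le> (K * m * b powr (p - 2) * t) / b powr (p - 1)"
      using le bpos by (intro divide_right_mono) auto
    also have "\<dots> = K * a * t" using bpos by (simp add: bb a_def field_simps)
    finally show ?thesis
      using b bpos Mpos by (simp add: A_def a_def powr_divide diff_divide_distrib)
  qed
  have a_bd: "a powr (2 - p) \<le> (1 + K) powr p"
  proof (cases "p \<le> 2")
    case True
    then have "a powr (2 - p) \<le> 1" using a by (intro powr_le1) auto
    also have "1 \<le> (1 + K) powr p" using K p by (intro ge_one_powr_ge_zero) auto
    finally show ?thesis .
  next
    case False
    have "1 \<le> A powr (p - 1)" using A p by (intro ge_one_powr_ge_zero) auto
    also have "\<dots> \<le> a powr (p - 1) + K * a * t" using le' by simp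
    also have "\<dots> \<le> a powr 1 + K * a"
      using a t K False by (intro add_mono powr_mono') (auto intro: mult_left_le)
    finally have "1 / a \<le> 1 + K" using a by (simp add: field_simps)
    then have "(1 / a) powr (p - 2) \<le> (1 + K) powr (p - 2)"
      using a False by (intro powr_mono2) auto
    also have "\<dots> \<le> (1 + K) powr p" using K by (intro powr_mono) auto
    also have "(1 / a) powr (p - 2) = a powr (2 - p)"
      using a by (simp add: powr_divide powr_minus_divide[of a "p - 2", symmetric])
    finally show ?thesis .
  qed
  define L s where "L = K * (1 + K) powr p" and "s = 1 / (p - 1)"
  have "q powr (p - 1) = A powr (p - 1) / a powr (p - 1)"
    using A a by (simp add: qA powr_divide)
  also have "\<dots> \<le> (a powr (p - 1) + K * a * t) / a powr (p - 1)"
    using le' a by (intro divide_right_mono) auto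
  also have "\<dots> = 1 + K * a powr (2 - p) * t"
    using a powr_diff[of a 1 "p - 1"] by (simp add: field_simps)
  also have "\<dots> \<le> 1 + L * t"
    unfolding L_def using a_bd K t by (intro add_left_mono mult_right_mono mult_left_mono) auto
  finally have qp: "q powr (p - 1) \<le> 1 + L * t" .
  have "q = (q powr (p - 1)) powr s"
    using q p by (simp add: s_def powr_powr)
  also have "\<dots> \<le> (1 + L * t) powr s"
    using qp p by (intro powr_mono2) (auto simp: s_def)
  also have "\<dots> \<le> 1 + s * L * exp (s * L) * t"
    using K p t by (intro powr_le_one_plus) (auto simp: L_def s_def)
  finally show ?thesis by (simp add: q_def L_def s_def Let_def)
qed

section \<open>Extremal graphs and their eigenvectors\<close>

text \<open>By homogeneity, a bound for vectors of norm 1 extends to all nonnegative vectors. This form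
  needs no normalisation of test vectors and can be differentiated in a single coordinate.\<close>

lemma edge_poly_le_homogeneous:
  assumes G: "rgraph r G" and p: "p > 0"
    and W: "spectral_radius r p G \<le> ereal (fact r * W)"
    and y: "\<And>v. v \<in> verts G \<Longrightarrow> 0 \<le> y v" and N: "0 < (\<Sum>v\<in>verts G. y v powr p)"
  shows "edge_poly (edges G) y \<le> W * (\<Sum>v\<in>verts G. y v powr p) powr (r / p)"
proof -
  define N where "N = (\<Sum>v\<in>verts G. y v powr p)"
  define c where "c = N powr (- (1 / p))"
  have Npos: "N > 0" and cpos: "c > 0" using N by (auto simp: N_def c_def)
  have cp: "c powr p = 1 / N"
    using Npos p by (simp add: c_def powr_powr)
  have "(\<Sum>v\<in>verts G. \<bar>c * y v\<bar> powr p) = c powr p * N"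
    using cpos y by (simp add: N_def sum_distrib_left powr_mult abs_mult)
  then have "pnorm p G (\<lambda>v. c * y v) = 1"
    using Npos by (simp add: pnorm_def cp)
  then have "ereal (lagrangian r G (\<lambda>v. c * y v)) \<le> spectral_radius r p G"
    unfolding spectral_radius_def by (intro SUP_upper) simp
  then have "ereal (lagrangian r G (\<lambda>v. c * y v)) \<le> ereal (fact r * W)" using W by order
  then have "edge_poly (edges G) (\<lambda>v. c * y v) \<le> W"
    by (simp add: lagrangian_def edge_poly_def)
  then have "c ^ r * edge_poly (edges G) y \<le> W"
    using G by (subst (asm) edge_poly_scale[of _ "verts G" r]) (auto simp: rgraph_def)
  moreover have "c ^ r = N powr (- (r / p))"
    using cpos by (simp add: c_def powr_powr flip: powr_realpow)
  ultimately have "edge_poly (edges G) y / N powr (r / p) \<le> W"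
    by (simp add: powr_minus_divide)
  then show ?thesis using Npos by (simp add: N_def[symmetric] pos_divide_le_eq)
qed

locale extremal =
  fixes r :: nat and p :: real and \<H> :: "nat hypergraph set" and n :: nat
    and G :: "nat hypergraph" and x :: "nat \<Rightarrow> real"
  assumes r: "2 \<le> r" and p: "1 < p" and rn: "r \<le> n"
    and forbidden: "\<And>H. H \<in> \<H> \<Longrightarrow> rgraph r H \<and> two_covering H \<and> \<not> r_partite r H"
    and G: "G \<in> free_family_upto r \<H> n"
    and attained: "spectral_radius r p G = max_spectral_radius r p \<H> n"
    and pf: "perron_frobenius r p G x"
begin

abbreviation "V \<equiv> verts G"
abbreviation "E \<equiv> edges G"
abbreviation "W \<equiv> edge_poly E x"

lemma rgraph: "rgraph r G"
  using G by (simp add: free_family_upto_def free_family_def)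

lemma finV: "finite V" and EV: "E \<subseteq> [V]\<^bsup>r\<^esup>"
  using rgraph by (auto simp: rgraph_def)

lemma x_pos: "v \<in> V \<Longrightarrow> x v > 0"
  using pf by (simp add: perron_frobenius_def)

lemma n_pos: "real n > 0"
  using r rn by simp

lemma sum_powr: "(\<Sum>v\<in>V. x v powr p) = 1"
proof -
  let ?S = "\<Sum>v\<in>V. x v powr p"
  have "(\<Sum>v\<in>V. \<bar>x v\<bar> powr p) = ?S" using x_pos by (intro sum.cong) (auto simp: less_imp_le)
  then have "?S powr (1 / p) = 1"
    using pf by (simp add: perron_frobenius_def principal_eigenvector_def pnorm_def)
  moreover have "(?S powr (1 / p)) powr p = ?S"
    using p by (simp add: powr_powr sum_nonneg)
  ultimately show ?thesis by simp
qed

lemma nonempty: "V \<noteq> {}"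
  using sum_powr by auto

text \<open>This is the only way in which extremality is used: any nonnegative test vector on any graph
  of the family yields an inequality for \<open>W\<close>.\<close>

lemma family_bound:
  assumes G': "G' \<in> free_family_upto r \<H> n" and y: "\<And>v. v \<in> verts G' \<Longrightarrow> 0 \<le> y v"
    and N: "0 < (\<Sum>v\<in>verts G'. y v powr p)"
  shows "edge_poly (edges G') y \<le> W * (\<Sum>v\<in>verts G'. y v powr p) powr (r / p)"
proof (rule edge_poly_le_homogeneous[OF _ _ _ y N])
  show "rgraph r G'" using G' by (simp add: free_family_upto_def free_family_def)
  have "spectral_radius r p G' \<le> max_spectral_radius r p \<H> n"
    unfolding max_spectral_radius_def by (rule SUP_upper[OF G'])
  also have "\<dots> = ereal (lagrangian r G x)"
    using pf attained by (simp add: perron_frobenius_def principal_eigenvector_def)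
  also have "\<dots> = ereal (fact r * W)" by (simp add: lagrangian_def edge_poly_def)
  finally show "spectral_radius r p G' \<le> ereal (fact r * W)" .
qed (use p in auto)

lemma clone_in_family:
  assumes "u \<in> V" "u \<noteq> z" "card (insert z V) \<le> n"
  shows "clone u z G \<in> free_family_upto r \<H> n"
proof -
  have "\<not> contains_copy (clone u z G) H" if "H \<in> \<H>" for H
    using contains_copy_clone[of H u G z] assms forbidden[OF that] G that
    by (auto simp: free_family_upto_def free_family_def simp del: split_paired_All)
  moreover have "rgraph r (clone u z G)" using r by (intro rgraph_clone rgraph) simp
  moreover have "card (verts (clone u z G)) \<le> n" using assms by (simp add: clone_def)
  ultimately show ?thesis unfolding free_family_upto_def free_family_def by blast
qed

lemma multipartite_in_family:
  assumes "r * k \<le> n"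
  shows "multipartite r k \<in> free_family_upto r \<H> n"
proof -
  have "r_partite r (multipartite r k)" using r by (intro r_partite_multipartite) simp
  then have "\<not> contains_copy (multipartite r k) H" if "H \<in> \<H>" for H
    using forbidden[OF that] r_partite_contains_copy[of r "multipartite r k" H] by blast
  then show ?thesis
    using rgraph_multipartite[of r k] assms
    by (simp add: free_family_upto_def free_family_def) (simp add: multipartite_def)
qed

lemma W_nonneg: "W \<ge> 0"
  using x_pos by (intro edge_poly_nonneg[OF EV]) (simp add: less_imp_le)

text \<open>The test vector is constant on the balanced complete \<open>r\<close>-partite graph with parts of size
  \<open>n div r\<close>. Rounding down loses at most a factor 2 in the part size, because \<open>r \<le> n\<close>.\<close>

lemma W_lower: "n powr (r * (1 - 1 / p)) \<le> (2 * r) ^ r * W"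
proof -
  define k where "k = n div r"
  have k: "k \<ge> 1" using rn r by (simp add: k_def div_greater_zero_iff Suc_leI)
  have rk: "r * k \<le> n" by (simp add: k_def)
  have "n < r * k + r"
    using r mult_div_mod_eq[of r n] mod_less_divisor[of r n] unfolding k_def by linarith
  also have "\<dots> \<le> 2 * r * k" using k mult_le_mono2[of 1 k r] by simp
  finally have nk: "real n \<le> (2 * r) * k" by (metis less_imp_le of_nat_le_iff)
  have T: "verts (multipartite r k) = {..<r * k}" by (simp add: multipartite_def)
  have "edge_poly (edges (multipartite r k)) (\<lambda>_. 1)
      \<le> W * (\<Sum>v\<in>verts (multipartite r k). 1 powr p) powr (r / p)"
    using k r by (intro family_bound multipartite_in_family rk) (auto simp: T)
  then have "real (k ^ r) \<le> W * real (r * k) powr (r / p)"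
    by (simp add: edge_poly_def card_edges_multipartite T)
  also have "\<dots> \<le> W * n powr (r / p)"
  proof (intro mult_left_mono powr_mono2 W_nonneg)
    show "real (r * k) \<le> real n" using rk by (simp only: of_nat_le_iff)
  qed (use p in auto)
  finally have kW: "real k ^ r \<le> W * n powr (r / p)" by simp
  have "n powr (r * (1 - 1 / p)) = n ^ r / n powr (r / p)"
    using n_pos by (simp add: right_diff_distrib powr_diff powr_realpow)
  also have "\<dots> \<le> ((2 * r) * k) ^ r / n powr (r / p)"
    using nk by (intro divide_right_mono) (auto simp flip: of_nat_mult intro: power_mono)
  also have "\<dots> = (2 * r) ^ r * (real k ^ r / n powr (r / p))" by (simp add: power_mult_distrib)
  also have "\<dots> \<le> (2 * r) ^ r * W"
    using kW n_pos by (intro mult_left_mono) (auto simp: pos_divide_le_eq)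
  finally show ?thesis .
qed

lemma W_pos: "W > 0"
proof -
  have "0 < n powr (r * (1 - 1 / p))" using n_pos by simp
  also note W_lower
  finally show ?thesis by (rule zero_less_mult_pos) (use r in simp)
qed

text \<open>Moving the coordinate \<open>v\<close> alone, the gap in the homogeneous inequality is a differentiable
  function with an interior minimum at \<open>x v > 0\<close>, so its derivative vanishes there.\<close>

lemma eigenvector_equation:
  assumes v: "v \<in> V"
  shows "edge_poly (link E v) x = r * W * x v powr (p - 1)"
proof -
  let ?D = "edge_poly (link E v) x"
  define S where "S = (\<Sum>u\<in>V - {v}. x u powr p)"
  have S: "S \<ge> 0" "S + x v powr p = 1"
    using sum_powr finV v by (auto simp: S_def sum_nonneg sum.remove)
  define f where "f s = W * (S + s powr p) powr (r / p) - (s - x v) * ?D" for s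
  have fx: "f (x v) = W" using S by (simp add: f_def)
  have f_ge: "W \<le> f s" if s: "s > 0" for s
  proof -
    let ?y = "x(v := s)"
    have sum: "(\<Sum>u\<in>V. ?y u powr p) = S + s powr p"
      using finV v by (simp add: S_def sum.remove[of _ v])
    have "edge_poly E ?y \<le> W * (\<Sum>u\<in>V. ?y u powr p) powr (r / p)"
    proof (rule family_bound[OF G])
      show "0 \<le> ?y u" if "u \<in> V" for u using x_pos[OF that] s by simp
      show "0 < (\<Sum>u\<in>V. ?y u powr p)" unfolding sum using S s by (intro add_nonneg_pos) auto
    qed
    then show ?thesis
      unfolding sum edge_poly_update[OF finV EV] by (simp add: f_def)
  qed
  have d1: "((\<lambda>s. S + s powr p) has_field_derivative p * x v powr (p - 1)) (at (x v))"
    using DERIV_add[OF DERIV_const[of S] has_real_derivative_powr[OF x_pos[OF v], of p]] by simp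
  have d2: "((\<lambda>s. (S + s powr p) powr (r / p)) has_field_derivative r * x v powr (p - 1)) (at (x v))"
    using DERIV_fun_powr[OF d1, of "r / p"] S p by simp
  have "((\<lambda>s. (s - x v) * ?D) has_field_derivative ?D) (at (x v))"
    by (auto intro!: derivative_eq_intros)
  then have "(f has_field_derivative W * (r * x v powr (p - 1)) - ?D) (at (x v))"
    unfolding f_def by (intro DERIV_diff DERIV_cmult d2)
  moreover have "\<forall>s. \<bar>x v - s\<bar> < x v \<longrightarrow> f (x v) \<le> f s"
    unfolding fx by (intro allI impI f_ge) linarith
  ultimately have "W * (r * x v powr (p - 1)) - ?D = 0"
    using x_pos[OF v] DERIV_local_min by blast
  then show ?thesis by (simp add: mult_ac)
qed

text \<open>With fewer than \<open>n\<close> vertices there is room for a twin of some \<open>w\<close>. Splitting the mass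
  \<open>x w powr p\<close> evenly between the twins keeps the norm, but their total weight
  \<open>2 powr (1 - 1/p) * x w\<close> exceeds \<open>x w\<close> since \<open>p > 1\<close>, which increases the value strictly.\<close>

lemma card_V: "card V = n"
proof (rule ccontr)
  assume "card V \<noteq> n"
  then have less: "card V < n" using G by (simp add: free_family_upto_def)
  obtain w where w: "w \<in> V" using nonempty by blast
  obtain z where z: "z \<notin> V" using finV infinite_UNIV_nat ex_new_if_finite by blast
  have wz: "w \<noteq> z" using w z by auto
  define a where "a = x w / 2 powr (1 / p)"
  have a: "a > 0" using x_pos[OF w] by (simp add: a_def)
  have ap: "a powr p + a powr p = x w powr p"
    using x_pos[OF w] p by (simp add: a_def powr_divide powr_powr)
  let ?y = "x(w := a, z := a)"
  have "(\<Sum>v\<in>verts (clone w z G). ?y v powr p) = ?y z powr p + (\<Sum>v\<in>V. ?y v powr p)"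
    by (simp only: clone_def fst_conv sum.insert[OF finV z])
  also have "(\<Sum>v\<in>V. ?y v powr p) = ?y w powr p + (\<Sum>v\<in>V - {w}. ?y v powr p)"
    by (rule sum.remove[OF finV w])
  also have "(\<Sum>v\<in>V - {w}. ?y v powr p) = (\<Sum>v\<in>V - {w}. x v powr p)"
    using z by (intro sum.cong) auto
  also have "?y z powr p + (?y w powr p + (\<Sum>v\<in>V - {w}. x v powr p))
      = x w powr p + (\<Sum>v\<in>V - {w}. x v powr p)"
    using ap wz by simp
  also have "\<dots> = 1" using sum.remove[OF finV w, of "\<lambda>v. x v powr p"] sum_powr by simp
  finally have sum: "(\<Sum>v\<in>verts (clone w z G). ?y v powr p) = 1" .
  have "edge_poly (edges (clone w z G)) ?y
      \<le> W * (\<Sum>v\<in>verts (clone w z G). ?y v powr p) powr (r / p)"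
  proof (rule family_bound)
    show "clone w z G \<in> free_family_upto r \<H> n"
      using w wz z finV less by (intro clone_in_family) auto
    show "0 \<le> ?y v" if "v \<in> verts (clone w z G)" for v
      using that x_pos a by (auto simp: clone_def less_imp_le)
  qed (simp only: sum zero_less_one)
  then have "edge_poly E (x(w := a + a, z := 0)) \<le> W"
    unfolding sum edge_poly_clone[OF rgraph wz] by simp
  also have "edge_poly E (x(w := a + a, z := 0)) = edge_poly E (x(w := a + a))"
    using z EV by (intro edge_poly_cong) (auto simp: nsets_def)
  also have "\<dots> = W + (a + a - x w) * (r * W * x w powr (p - 1))"
    by (simp add: edge_poly_update[OF finV EV] eigenvector_equation[OF w])
  finally have "(a + a - x w) * (r * W * x w powr (p - 1)) \<le> 0" by simp
  moreover have "r * W * x w powr (p - 1) > 0" using r W_pos x_pos[OF w] by simp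
  moreover have "a + a - x w > 0"
  proof -
    have "2 powr (1 / p) < 2 powr (1::real)" using p by (intro powr_less_mono) auto
    then show ?thesis using x_pos[OF w] by (simp add: a_def field_simps)
  qed
  ultimately show False by (metis mult_pos_pos not_le)
qed

text \<open>The test vector on the cloned graph is \<open>x\<close> itself: the twin of \<open>u\<close> takes over the name and the
  weight of \<open>w\<close>. In terms of \<open>G\<close>, the weight of \<open>w\<close> is moved to \<open>u\<close>.\<close>

lemma replace_by_clone:
  assumes u: "u \<in> V" and w: "w \<in> V" and uw: "u \<noteq> w"
  shows "r * W * (x u powr (p - 1) - x w powr (p - 1)) \<le> x w * edge_poly (link (link E u) w) x"
proof -
  let ?Du = "edge_poly (link E u) x" and ?Dw = "edge_poly (link E w) x"
    and ?C = "edge_poly (link (link E u) w) x"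
  have ins: "insert w V = V" using w by auto
  have vc: "verts (clone u w G) = V" using ins by (simp add: clone_def)
  have "edge_poly (edges (clone u w G)) x \<le> W * (\<Sum>v\<in>V. x v powr p) powr (r / p)"
    using family_bound[OF clone_in_family[OF u uw], of x] ins card_V x_pos
    by (simp add: vc sum_powr less_imp_le)
  then have "edge_poly E (x(u := x u + x w, w := 0)) \<le> W"
    using edge_poly_clone[OF rgraph uw, of x "x u" "x w"] by (simp add: sum_powr)
  also have "x(u := x u + x w, w := 0) = (x(w := 0))(u := x u + x w)" using uw by auto
  also have "edge_poly E ((x(w := 0))(u := x u + x w))
      = edge_poly E (x(w := 0)) + x w * edge_poly (link E u) (x(w := 0))"
    using uw by (simp add: edge_poly_update[OF finV EV])
  also have "edge_poly E (x(w := 0)) = W - x w * ?Dw"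
    by (simp add: edge_poly_update[OF finV EV])
  also have "edge_poly (link E u) (x(w := 0)) = ?Du - x w * ?C"
    using finV by (simp add: edge_poly_update[OF _ link_nsets[OF EV]])
  finally have "x w * (?Du - ?Dw) \<le> x w * (x w * ?C)" by (simp add: algebra_simps)
  then have "?Du - ?Dw \<le> x w * ?C" using x_pos[OF w] by simp
  then show ?thesis
    by (simp add: eigenvector_equation[OF u] eigenvector_equation[OF w] algebra_simps)
qed

lemma sum_le: "(\<Sum>v\<in>V. x v) \<le> n powr (1 - 1 / p)"
proof -
  let ?s = "(\<Sum>v\<in>V. x v) / n"
  have s: "(\<Sum>v\<in>V. x v) \<ge> 0" using x_pos by (intro sum_nonneg) (simp add: less_imp_le)
  have "?s powr p \<le> 1 / n"
    using power_mean_powr[OF finV nonempty, of p x] p x_pos by (simp add: card_V sum_powr)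
  then have "(?s powr p) powr (1 / p) \<le> (1 / n) powr (1 / p)"
    using p by (intro powr_mono2) auto
  then have "?s \<le> 1 / n powr (1 / p)" using s p n_pos by (simp add: powr_powr powr_divide)
  then show ?thesis using n_pos by (simp add: powr_diff field_simps)
qed

lemma codegree_le: "edge_poly (link (link E u) w) x \<le> n powr ((r - 2) * (1 - 1 / p))"
proof -
  have "link (link E u) w \<subseteq> nsets (V - {u} - {w}) (r - 1 - 1)"
    by (intro link_nsets EV)
  also have "\<dots> \<subseteq> nsets V (r - 1 - 1)" by (rule nsets_mono) auto
  also have "r - 1 - 1 = r - 2" by simp
  finally have "edge_poly (link (link E u) w) x \<le> (\<Sum>v\<in>V. x v) ^ (r - 2)"
    using x_pos by (intro edge_poly_le_power finV) (auto simp: less_imp_le)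
  also have "\<dots> \<le> (n powr (1 - 1 / p)) ^ (r - 2)"
    using sum_le x_pos by (intro power_mono sum_nonneg) (auto simp: less_imp_le)
  also have "\<dots> = n powr ((r - 2) * (1 - 1 / p))"
    using n_pos by (simp add: powr_powr mult.commute flip: powr_realpow)
  finally show ?thesis .
qed

text \<open>The bounds on \<open>W\<close> and on the codegree leave the factor \<open>n powr (- 2 (1 - 1/p))\<close>. It is rewritten
  in terms of \<open>n powr (- 1/p)\<close>, the coordinate of a constant unit vector, which is the natural scale
  for comparing \<open>x u\<close> and \<open>x w\<close>.\<close>

lemma coordinate_gap:
  assumes u: "u \<in> V" and w: "w \<in> V"
  shows "x u powr (p - 1) - x w powr (p - 1)
    \<le> (2 * r) ^ r * x w * (n powr (- (1 / p))) powr (p - 2) * (1 / n)"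
proof (cases "x u powr (p - 1) \<le> x w powr (p - 1)")
  case True
  moreover have "0 \<le> (2 * r) ^ r * x w * (n powr (- (1 / p))) powr (p - 2) * (1 / n)"
    using x_pos[OF w] by simp
  ultimately show ?thesis by linarith
next
  case False
  define \<Delta> \<kappa> where "\<Delta> = x u powr (p - 1) - x w powr (p - 1)" and "\<kappa> = 1 - 1 / p"
  have \<Delta>: "\<Delta> > 0" and uw: "u \<noteq> w" using False by (auto simp: \<Delta>_def)
  have "1 * (W * \<Delta>) \<le> r * (W * \<Delta>)"
    using r mult_pos_pos[OF W_pos \<Delta>] by (intro mult_right_mono) simp_all
  also have "\<dots> \<le> x w * edge_poly (link (link E u) w) x"
    using replace_by_clone[OF u w uw] by (simp add: \<Delta>_def mult.assoc)
  also have "\<dots> \<le> x w * n powr ((r - 2) * \<kappa>)"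
    using codegree_le x_pos[OF w] by (intro mult_left_mono) (auto simp: \<kappa>_def)
  finally have WD: "W * \<Delta> \<le> x w * n powr ((r - 2) * \<kappa>)" by simp
  have "n powr (r * \<kappa>) * \<Delta> \<le> (2 * r) ^ r * W * \<Delta>"
    using W_lower \<Delta> by (intro mult_right_mono) (auto simp: \<kappa>_def)
  also have "\<dots> \<le> (2 * r) ^ r * (x w * n powr ((r - 2) * \<kappa>))"
    using WD by (simp add: mult.assoc mult_left_mono)
  finally have "\<Delta> \<le> (2 * r) ^ r * (x w * n powr ((r - 2) * \<kappa>)) / n powr (r * \<kappa>)"
    using n_pos by (simp add: pos_le_divide_eq mult.commute)
  also have "\<dots> = (2 * r) ^ r * x w * n powr ((r - 2) * \<kappa> - r * \<kappa>)"
    by (simp add: powr_diff)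
  also have "(r - 2) * \<kappa> - r * \<kappa> = - (1 / p) * (p - 2) - 1"
    using r p by (simp add: \<kappa>_def of_nat_diff field_simps)
  also have "n powr (- (1 / p) * (p - 2) - 1) = n powr (- (1 / p) * (p - 2)) * (1 / n)"
    using n_pos by (subst powr_diff) simp
  also have "n powr (- (1 / p) * (p - 2)) = (n powr (- (1 / p))) powr (p - 2)"
    by (simp only: powr_powr)
  finally show ?thesis by (simp add: \<Delta>_def mult.assoc)
qed

lemma coordinates_around_mean:
  obtains u w where "u \<in> V" "w \<in> V" "n powr (- (1 / p)) \<le> x u" "x w \<le> n powr (- (1 / p))"
proof -
  let ?b = "n powr (- (1 / p))"
  have "?b powr p = 1 / n" using p n_pos by (simp add: powr_powr)
  then have bp: "(\<Sum>v\<in>V. ?b powr p) = 1" using n_pos by (simp only: sum_constant card_V) simp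
  have "\<exists>u\<in>V. ?b \<le> x u"
  proof (rule ccontr)
    assume "\<not> ?thesis"
    then have "(\<Sum>v\<in>V. x v powr p) < (\<Sum>v\<in>V. ?b powr p)"
      using finV nonempty x_pos p
      by (intro sum_strict_mono powr_less_mono2) (auto simp: not_le less_imp_le)
    then show False using bp sum_powr by simp
  qed
  moreover have "\<exists>w\<in>V. x w \<le> ?b"
  proof (rule ccontr)
    assume "\<not> ?thesis"
    then have "(\<Sum>v\<in>V. ?b powr p) < (\<Sum>v\<in>V. x v powr p)"
      using finV nonempty p
      by (intro sum_strict_mono powr_less_mono2) (auto simp: not_le)
    then show False using bp sum_powr by simp
  qed
  ultimately show ?thesis using that by blast
qed

lemma principal_ratio_bound:
  defines "K \<equiv> real ((2 * r) ^ r)"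
  shows "\<bar>principal_ratio G x - 1\<bar>
    \<le> (let L = K * (1 + K) powr p; s = 1 / (p - 1) in s * L * exp (s * L)) / n"
proof -
  define M m where "M = Max (x ` V)" and "m = Min (x ` V)"
  have "M \<in> x ` V" "m \<in> x ` V"
    unfolding M_def m_def using finV nonempty by (simp_all add: Max_in Min_in)
  then obtain u w where u: "u \<in> V" "M = x u" and w: "w \<in> V" "m = x w" by blast
  have Mm: "x v \<le> M" "m \<le> x v" if "v \<in> V" for v
    using that finV by (auto simp: M_def m_def)
  have m: "m > 0" using w x_pos by simp
  obtain u' w' where "u' \<in> V" "w' \<in> V" "n powr (- (1 / p)) \<le> x u'" "x w' \<le> n powr (- (1 / p))"
    by (rule coordinates_around_mean)
  then have b: "m \<le> n powr (- (1 / p))" "n powr (- (1 / p)) \<le> M"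
    using Mm(1)[of u'] Mm(2)[of w'] by linarith+
  let ?C = "let L = K * (1 + K) powr p; s = 1 / (p - 1) in s * L * exp (s * L)"
  have "M / m \<le> 1 + ?C * (1 / n)"
    using p r rn m b coordinate_gap[OF u(1) w(1)] u w
    by (intro ratio_bound) (auto simp: K_def)
  then have Mm_le: "M / m \<le> 1 + ?C / n" by simp
  have le: "x a / x c \<le> M / m" if "a \<in> V" "c \<in> V" for a c
    using that Mm m x_pos[OF u(1)] u by (intro frac_le) (auto simp: less_imp_le)
  have "principal_ratio G x \<le> M / m"
    unfolding principal_ratio_def using nonempty le by (intro cSUP_least) auto
  moreover have "1 \<le> principal_ratio G x"
  proof -
    have "(case (u, u) of (a, c) \<Rightarrow> x a / x c) \<le> principal_ratio G x"
      unfolding principal_ratio_def using u finV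
      by (intro cSUP_upper bdd_above_finite finite_imageI finite_cartesian_product) auto
    then show ?thesis using x_pos[OF u(1)] by simp
  qed
  ultimately show ?thesis using Mm_le by linarith
qed

end

theorem theorem1p3:
  fixes r :: nat and p :: real
  assumes "r \<ge> 2" and "p > 1"
  shows "\<exists>C>0. \<forall>(\<H> :: nat hypergraph set) (n :: nat) (G :: nat hypergraph) (x :: nat \<Rightarrow> real).
           r \<le> n \<longrightarrow>
           (\<forall>H\<in>\<H>. rgraph r H \<and> two_covering H \<and> \<not> r_partite r H) \<longrightarrow>
           G \<in> free_family_upto r \<H> n \<longrightarrow>
           spectral_radius r p G = max_spectral_radius r p \<H> n \<longrightarrow>
           perron_frobenius r p G x \<longrightarrow>
           \<bar>principal_ratio G x - 1\<bar> \<le> C / real n"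
proof -
  define K L s where "K = real ((2 * r) ^ r)" and "L = K * (1 + K) powr p" and "s = 1 / (p - 1)"
  have K: "K > 0" using assms(1) by (simp add: K_def)
  have "L > 0" unfolding L_def using K by (intro mult_pos_pos) auto
  moreover have "s > 0" using assms(2) by (simp add: s_def)
  ultimately have "s * L * exp (s * L) > 0" by simp
  moreover have "\<bar>principal_ratio G x - 1\<bar> \<le> s * L * exp (s * L) / n"
    if "r \<le> n" "\<forall>H\<in>\<H>. rgraph r H \<and> two_covering H \<and> \<not> r_partite r H"
      "G \<in> free_family_upto r \<H> n" "spectral_radius r p G = max_spectral_radius r p \<H> n"
      "perron_frobenius r p G x" for \<H> n G x
  proof -
    interpret extremal r p \<H> n G x by unfold_locales (use assms that in auto)
    show ?thesis using principal_ratio_bound by (simp add: K_def L_def s_def Let_def)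
  qed
  ultimately show ?thesis by blast
qed

end
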